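(* Let $\mathcal{H}$ be a separable complex Hilbert space, let $C \in GL(\mathcal{H})$, and let $\Psi = (\psi_n)_{n\in\Gamma}$ be a $C$-controlled frame in $\mathcal{H}$. Then $\Psi$ is a (classical) frame for $\mathcal{H}$. Furthermore, if $L$ denotes the frame operator of $\Psi$, then $C L = L C^*$, and so $$\sum_{n\in\Gamma} \langle f, \psi_n\rangle\, C\psi_n = \sum_{n\in\Gamma} \langle f, C\psi_n\rangle\, \psi_n \qquad \text{for all } f \in \mathcal{H}.$$
   Context: The inner product $\langle\cdot,\cdot\rangle$ is linear in the first coordinate. $\Gamma$ is a countable index set (series are taken with respect to a fixed enumeration). $GL(\mathcal{H})$ is the set of bounded linear operators on $\mathcal{H}$ with a bounded inverse. A sequence $\Psi=(\psi_n)_{n\in\Gamma}$ in $\mathcal{H}$ is a (classical) frame if there are constants $m>0$, $M<\infty$ with $m\|f\|^2 \le \sum_{n} |\langle f,\psi_n\rangle|^2 \le M\|f\|^2$ for all $f\in\mathcal{H}$. Its frame operator is $L f = \sum_n \langle f,\psi_n\rangle \psi_n$. For $C\in GL(\mathcal{H})$, a family $\Psi=(\psi_n)_{n\in\Gamma}$ in $\mathcal{H}$ is a $C$-controlled frame (a frame controlled by $C$) if there are constants $m_{CL}>0$, $M_{CL}<\infty$ such that for all $f\in\mathcal{H}$ the following series converges and $$m_{CL}\|f\|^2 \le \sum_{n} \langle \psi_n, f\rangle\langle f, C\psi_n\rangle \le M_{CL}\|f\|^2$$ (in particular the sum is real). *)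

theory Defs
  imports "HOL-Analysis.Analysis"
begin

class complex_vector = real_vector +
  fixes scaleC :: "complex \<Rightarrow> 'a \<Rightarrow> 'a" (infixr "*\<^sub>C" 75)
  assumes scaleC_add_right: "a *\<^sub>C (x + y) = a *\<^sub>C x + a *\<^sub>C y"
    and scaleC_add_left: "(a + b) *\<^sub>C x = a *\<^sub>C x + b *\<^sub>C x"
    and scaleC_scaleC: "a *\<^sub>C (b *\<^sub>C x) = (a * b) *\<^sub>C x"
    and scaleR_scaleC: "r *\<^sub>R x = complex_of_real r *\<^sub>C x"

text \<open>The inner product is linear in the first argument and conjugate-linear in the second.
  Definiteness follows from the norm axiom.\<close>

class complex_inner = complex_vector + real_normed_vector +
  fixes cinner :: "'a \<Rightarrow> 'a \<Rightarrow> complex"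
  assumes cinner_commute: "cinner x y = cnj (cinner y x)"
    and cinner_add_left: "cinner (x + y) z = cinner x z + cinner y z"
    and cinner_scaleC_left: "cinner (a *\<^sub>C x) y = a * cinner x y"
    and cinner_ge_zero: "0 \<le> Re (cinner x x)"
    and norm_eq_sqrt_cinner: "norm x = sqrt (Re (cinner x x))"

class complex_hilbert_space = complex_inner + complete_space

definition bounded_clinear :: "('a::complex_inner \<Rightarrow> 'b::complex_inner) \<Rightarrow> bool" where
  "bounded_clinear T \<longleftrightarrow> bounded_linear T \<and> (\<forall>a x. T (a *\<^sub>C x) = a *\<^sub>C T x)"

definition GL :: "('a::complex_inner \<Rightarrow> 'a) set" where
  "GL = {T. bounded_clinear T \<and> (\<exists>S. bounded_clinear S \<and> S \<circ> T = id \<and> T \<circ> S = id)}"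

text \<open>The complex analogue of \<^const>\<open>adjoint\<close>; on a Hilbert space, every bounded operator has
  exactly one such \<open>S\<close>.\<close>

definition cadjoint :: "('a::complex_inner \<Rightarrow> 'b::complex_inner) \<Rightarrow> 'b \<Rightarrow> 'a" where
  "cadjoint T = (SOME S. \<forall>x y. cinner (T x) y = cinner x (S y))"

text \<open>Series over a finite or countably infinite index set \<open>I\<close>, taken with respect to a fixed
  enumeration \<open>e\<close> of \<open>I\<close>. For finite \<open>I\<close> only the values of \<open>e\<close> below \<open>card I\<close> are relevant, and
  the series is padded with zeros. For infinite \<open>I\<close> convergence may be conditional.\<close>

definition positions :: "'i set \<Rightarrow> nat set" where
  "positions I = (if finite I then {..<card I} else UNIV)"

definition enumerates :: "(nat \<Rightarrow> 'i) \<Rightarrow> 'i set \<Rightarrow> bool" where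
  "enumerates e I \<longleftrightarrow> bij_betw e (positions I) I"

definition series_term ::
    "(nat \<Rightarrow> 'i) \<Rightarrow> 'i set \<Rightarrow> ('i \<Rightarrow> 'b::real_normed_vector) \<Rightarrow> nat \<Rightarrow> 'b" where
  "series_term e I x k = (if k \<in> positions I then x (e k) else 0)"

definition is_frame :: "(nat \<Rightarrow> 'i) \<Rightarrow> 'i set \<Rightarrow> ('i \<Rightarrow> 'a::complex_inner) \<Rightarrow> bool" where
  "is_frame e I \<psi> \<longleftrightarrow>
    (\<exists>m M. m > 0 \<and> (\<forall>f. \<exists>s.
      series_term e I (\<lambda>n. (cmod (cinner f (\<psi> n)))\<^sup>2) sums s \<and>
      m * (norm f)\<^sup>2 \<le> s \<and> s \<le> M * (norm f)\<^sup>2))"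

definition frame_operator ::
    "(nat \<Rightarrow> 'i) \<Rightarrow> 'i set \<Rightarrow> ('i \<Rightarrow> 'a::complex_inner) \<Rightarrow> 'a \<Rightarrow> 'a" where
  "frame_operator e I \<psi> f = suminf (series_term e I (\<lambda>n. cinner f (\<psi> n) *\<^sub>C \<psi> n))"

definition controlled_frame ::
    "(nat \<Rightarrow> 'i) \<Rightarrow> 'i set \<Rightarrow> ('a \<Rightarrow> 'a) \<Rightarrow> ('i \<Rightarrow> 'a::complex_inner) \<Rightarrow> bool" where
  "controlled_frame e I C \<psi> \<longleftrightarrow>
    (\<exists>m M. m > 0 \<and> (\<forall>f. \<exists>s::real.
      series_term e I (\<lambda>n. cinner (\<psi> n) f * cinner f (C (\<psi> n))) sums complex_of_real s \<and>
      m * (norm f)\<^sup>2 \<le> s \<and> s \<le> M * (norm f)\<^sup>2))"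

end

theory Submission
  imports Defs
begin

text \<open>
  Write \<open>B(f, g)\<close> for the sum of \<open>\<langle>f, C \<psi>\<^sub>n\<rangle> \<langle>\<psi>\<^sub>n, g\<rangle>\<close>. The hypothesis controls only the diagonal values
  \<open>B(f, f)\<close>, and the series may converge only conditionally. The estimates on \<open>B\<close> therefore
  go through forms rather than through absolute values of the terms.

  By polarization the series \<open>B(f, g)\<close> converges for all \<open>f\<close> and \<open>g\<close>, so \<open>B\<close> is a sesquilinear
  form. Its diagonal is real and nonnegative, hence \<open>B\<close> is Hermitian and satisfies the
  Cauchy--Schwarz inequality, which gives \<open>\<bar>B(f, g)\<bar> \<le> M \<parallel>f\<parallel> \<parallel>g\<parallel>\<close>.

  The upper frame bound comes from cancelling \<open>C\<close>. If \<open>D\<close> is the inverse of \<open>C\<close>, then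
  \<open>\<langle>D\<^sup>*f, C \<psi>\<^sub>n\<rangle> = \<langle>f, \<psi>\<^sub>n\<rangle>\<close>, so the sum of \<open>\<bar>\<langle>f, \<psi>\<^sub>n\<rangle>\<bar>\<^sup>2\<close> is \<open>B(D\<^sup>*f, f)\<close>, which converges and is at
  most \<open>M \<parallel>D\<^sup>*\<parallel> \<parallel>f\<parallel>\<^sup>2\<close> (\<open>bessel_bound\<close>). Once this is known, the frame operator \<open>L\<close> is given by a
  norm-convergent series (\<open>bessel_series_summable\<close>), and \<open>B(f, g) = \<langle>L C\<^sup>*f, g\<rangle>\<close>.

  The lower frame bound is Cauchy--Schwarz again, now for the form \<open>\<langle>L f, g\<rangle>\<close>: the number
  \<open>m \<parallel>f\<parallel>\<^sup>2 \<le> B(f, f) = \<langle>L C\<^sup>*f, f\<rangle>\<close> is bounded by the geometric mean of \<open>\<langle>L C\<^sup>*f, C\<^sup>*f\<rangle>\<close>, which is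
  \<open>O(\<parallel>f\<parallel>\<^sup>2)\<close>, and of \<open>\<langle>L f, f\<rangle>\<close> (\<open>lower_frame_bound\<close>).

  Finally \<open>B\<close> and the form of \<open>L\<close> are both Hermitian, so
  \<open>\<langle>C L f, g\<rangle> = \<langle>L f, C\<^sup>*g\<rangle> = cnj B(g, f) = B(f, g) = \<langle>L C\<^sup>*f, g\<rangle>\<close>, which is \<open>C L = L C\<^sup>*\<close>
  (\<open>intertwining\<close>).
\<close>

section \<open>Sesquilinear and positive forms\<close>

lemma scaleC_zero_left: "0 *\<^sub>C x = (0::'a::complex_vector)"
  using scaleR_scaleC[of 0 x] by simp

lemma scaleC_minus1: "(-1) *\<^sub>C x = - (x::'a::complex_vector)"
  using scaleR_scaleC[of "-1" x] by simp

locale sesquilinear_form =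
  fixes B :: "'a::complex_vector \<Rightarrow> 'a \<Rightarrow> complex"
  assumes add_left: "B (x + y) z = B x z + B y z"
    and add_right: "B x (y + z) = B x y + B x z"
    and scale_left: "B (a *\<^sub>C x) y = a * B x y"
    and scale_right: "B x (a *\<^sub>C y) = cnj a * B x y"
begin

lemma minus_left: "B (- x) y = - B x y"
  using scale_left[of "-1" x y] by (simp add: scaleC_minus1)

lemma minus_right: "B x (- y) = - B x y"
  using scale_right[of x "-1" y] by (simp add: scaleC_minus1)

lemma diff_left: "B (x - y) z = B x z - B y z"
  using add_left[of x "-y" z] by (simp add: minus_left)

lemma diff_right: "B x (y - z) = B x y - B x z"
  using add_right[of x y "-z"] by (simp add: minus_right)

lemma zero_left: "B 0 y = 0"
  using diff_left[of y y y] by simp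

lemma zero_right: "B x 0 = 0"
  using diff_right[of x x x] by simp

lemma polarization:
  "4 * B x y = B (x + y) (x + y) - B (x - y) (x - y)
     + \<i> * B (x + \<i> *\<^sub>C y) (x + \<i> *\<^sub>C y) - \<i> * B (x - \<i> *\<^sub>C y) (x - \<i> *\<^sub>C y)"
  by (simp add: add_left add_right diff_left diff_right scale_left scale_right algebra_simps)

end

locale positive_form = sesquilinear_form +
  assumes diag_real: "Im (B x x) = 0"
    and diag_ge_zero: "0 \<le> Re (B x x)"
begin

text \<open>A sesquilinear form with real diagonal is Hermitian: that the diagonal at \<open>x + y\<close> is real
  compares the imaginary parts of \<open>B x y\<close> and \<open>B y x\<close>, and that at \<open>x + \<i> y\<close> compares their
  real parts.\<close>

lemma hermitian: "B y x = cnj (B x y)"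
proof -
  have "Im (B x y + B y x) = 0"
    using diag_real[of "x + y"] diag_real[of x] diag_real[of y]
    by (simp add: add_left add_right)
  moreover have "Re (B x y) = Re (B y x)"
    using diag_real[of "x + \<i> *\<^sub>C y"] diag_real[of x] diag_real[of y]
    by (simp add: add_left add_right scale_left scale_right)
  ultimately show ?thesis
    by (simp add: complex_eq_iff)
qed

text \<open>The form need not be definite. With \<open>a = B x y\<close>, positivity along the vectors \<open>x - t a y\<close>,
  \<open>t\<close> real, is a quadratic inequality in \<open>t\<close>. If \<open>B y y \<noteq> 0\<close>, its value at \<open>t = 1 / B y y\<close> is the
  claim. Otherwise the left-hand side is affine in \<open>t\<close>, and being bounded below it is
  constant, so \<open>a = 0\<close>.\<close>

lemma Cauchy_Schwarz: "(cmod (B x y))\<^sup>2 \<le> Re (B x x) * Re (B y y)"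
proof -
  define a where "a = B x y"
  define s where "s = (cmod a)\<^sup>2"
  have s: "cnj a * a = complex_of_real s"
    unfolding s_def using complex_norm_square[of a] by (simp add: mult.commute)
  have quad: "0 \<le> Re (B x x) - 2 * t * s + t\<^sup>2 * s * Re (B y y)" for t :: real
  proof -
    let ?c = "complex_of_real t * a"
    have "B (x - ?c *\<^sub>C y) (x - ?c *\<^sub>C y)
        = B x x - cnj ?c * a - ?c * cnj a + ?c * cnj ?c * B y y"
      using hermitian[of y x]
      by (simp add: diff_left diff_right scale_left scale_right a_def algebra_simps)
    also have "\<dots> = B x x - of_real (2 * t * s) + of_real (t\<^sup>2 * s) * B y y"
      using s by (simp add: power2_eq_square algebra_simps flip: s)
    finally have "B (x - ?c *\<^sub>C y) (x - ?c *\<^sub>C y)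
        = B x x - of_real (2 * t * s) + of_real (t\<^sup>2 * s) * B y y" .
    then show ?thesis
      using diag_ge_zero[of "x - ?c *\<^sub>C y"] by simp
  qed
  have "s \<le> Re (B x x) * Re (B y y)"
  proof (cases "Re (B y y) = 0")
    case True
    have "s = 0"
    proof (rule ccontr)
      assume "s \<noteq> 0"
      then show False
        using quad[of "(Re (B x x) + 1) / (2 * s)"] True by (simp add: field_simps)
    qed
    then show ?thesis using True by simp
  next
    case False
    then have "Re (B y y) > 0" using diag_ge_zero[of y] by simp
    then show ?thesis
      using quad[of "1 / Re (B y y)"] by (simp add: field_simps power2_eq_square)
  qed
  then show ?thesis by (simp add: s_def a_def)
qed

end

section \<open>Complex inner product spaces\<close>

interpretation cinner: positive_form "cinner :: 'a::complex_inner \<Rightarrow> 'a \<Rightarrow> complex"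
proof
  fix x y z :: 'a and a :: complex
  show "cinner (x + y) z = cinner x z + cinner y z" by (rule cinner_add_left)
  show "cinner x (y + z) = cinner x y + cinner x z"
    using cinner_commute[of x] by (metis cinner_add_left complex_cnj_add)
  show "cinner (a *\<^sub>C x) y = a * cinner x y" by (rule cinner_scaleC_left)
  show "cinner x (a *\<^sub>C y) = cnj a * cinner x y"
    using cinner_commute[of x] by (metis cinner_scaleC_left complex_cnj_mult)
  show "Im (cinner x x) = 0"
    using arg_cong[OF cinner_commute[of x x], of Im] by simp
  show "0 \<le> Re (cinner x x)" by (rule cinner_ge_zero)
qed

lemma Re_cinner_self: "Re (cinner x x) = (norm x)\<^sup>2"
  by (simp add: norm_eq_sqrt_cinner cinner_ge_zero)

lemma cinner_self: "cinner x x = of_real ((norm x)\<^sup>2)"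
  by (simp add: complex_eq_iff Re_cinner_self cinner.diag_real del: of_real_power)

lemma cmod_cinner_le: "cmod (cinner x y) \<le> norm x * norm y"
proof (rule power2_le_imp_le)
  show "(cmod (cinner x y))\<^sup>2 \<le> (norm x * norm y)\<^sup>2"
    using cinner.Cauchy_Schwarz[of x y] by (simp add: Re_cinner_self power_mult_distrib)
qed simp

lemma cinner_mult_commute: "cinner x y * cinner y x = of_real ((cmod (cinner x y))\<^sup>2)"
  using cinner_commute[of y x] complex_norm_square[of "cinner x y"] by simp

lemma norm_scaleC: "norm (a *\<^sub>C x) = cmod a * norm (x::'a::complex_inner)"
proof (rule power2_eq_imp_eq)
  have "cinner (a *\<^sub>C x) (a *\<^sub>C x) = (a * cnj a) * cinner x x"
    by (simp add: cinner.scale_left cinner.scale_right)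
  also have "a * cnj a = of_real ((cmod a)\<^sup>2)"
    using complex_norm_square[of a] by simp
  finally show "(norm (a *\<^sub>C x))\<^sup>2 = (cmod a * norm x)\<^sup>2"
    by (simp add: cinner_self power_mult_distrib flip: of_real_mult of_real_power)
qed simp_all

lemma bounded_linear_cinner_left: "bounded_linear (\<lambda>x. cinner x y)"
proof (rule bounded_linear_intro[where K = "norm y"])
  show "cinner (r *\<^sub>R x) y = r *\<^sub>R cinner x y" for r x
    by (simp add: scaleR_scaleC cinner.scale_left scaleR_conv_of_real)
qed (simp_all add: cinner.add_left cmod_cinner_le)

lemma cinner_eqI_left: "(\<And>z. cinner x z = cinner y z) \<Longrightarrow> x = y"
proof -
  assume "\<And>z. cinner x z = cinner y z"
  then have "cinner (x - y) (x - y) = 0" by (simp add: cinner.diff_left)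
  then show "x = y" by (simp add: cinner_self)
qed

section \<open>Riesz representation and adjoints\<close>

instance complex_hilbert_space \<subseteq> banach ..

text \<open>The representing vector is the minimizer of \<open>J x = \<parallel>x\<parallel>\<^sup>2 - 2 Re (\<phi> x)\<close>: if \<open>\<phi>\<close> is represented by
  \<open>y\<close>, then \<open>J x = \<parallel>x - y\<parallel>\<^sup>2 - \<parallel>y\<parallel>\<^sup>2\<close>. The parallelogram law makes every minimizing sequence of \<open>J\<close>
  Cauchy, and the vanishing of the first variation at the limit is the representation.\<close>

lemma Riesz_representation:
  fixes \<phi> :: "'a::complex_hilbert_space \<Rightarrow> complex"
  assumes "bounded_linear \<phi>" and hom: "\<And>a x. \<phi> (a *\<^sub>C x) = a * \<phi> x"
  shows "\<exists>y. \<forall>x. \<phi> x = cinner x y"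
proof -
  interpret \<phi>: bounded_linear \<phi> by fact
  obtain K where K: "\<And>x. cmod (\<phi> x) \<le> norm x * K" "K > 0"
    using \<phi>.pos_bounded by blast
  define J where "J x = (norm x)\<^sup>2 - 2 * Re (\<phi> x)" for x
  have J_add: "J (x + h) = J x + (norm h)\<^sup>2 + 2 * Re (cinner h x - \<phi> h)" for x h
  proof -
    have "Re (cinner x h) = Re (cinner h x)" using cinner_commute[of x h] by simp
    then show ?thesis
      by (simp add: J_def \<phi>.add cinner.add_left cinner.add_right flip: Re_cinner_self)
  qed
  have "- K\<^sup>2 \<le> J x" for x
  proof -
    have "Re (\<phi> x) \<le> norm x * K" using K(1)[of x] complex_Re_le_cmod order_trans by blast
    moreover have "0 \<le> (norm x - K)\<^sup>2" by simp
    ultimately show ?thesis unfolding J_def by (simp add: power2_diff algebra_simps)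
  qed
  then have bdd: "bdd_below (range J)" by (intro bdd_belowI[of _ "- K\<^sup>2"]) auto
  define I where "I = Inf (range J)"
  have I_le: "I \<le> J x" for x unfolding I_def using bdd by (simp add: cInf_lower)
  have "\<exists>x. J x < I + inverse (Suc n)" for n
    using cInf_lessD[of "range J" "I + inverse (real (Suc n))"] by (auto simp: I_def)
  then obtain X where X: "\<And>n. J (X n) < I + inverse (real (Suc n))" by metis
  \<comment> \<open>The parallelogram law: the midpoint of two near-minimizers is no better than \<open>I\<close>.\<close>
  have dist_X: "(norm (x - y))\<^sup>2 \<le> 2 * (J x - I) + 2 * (J y - I)" for x y
  proof -
    let ?h = "(1/2) *\<^sub>R (x - y)" and ?z = "(1/2) *\<^sub>R (x + y)"
    have *: "?z + ?h = x" "?z + - ?h = y"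
      by (simp_all add: scaleR_add_right scaleR_diff_right flip: scaleR_add_left)
    have "J x + J y = 2 * J ?z + 2 * (norm ?h)\<^sup>2"
      using J_add[of ?z ?h] J_add[of ?z "- ?h"] unfolding *
      by (simp add: cinner.minus_left \<phi>.neg)
    also have "(norm ?h)\<^sup>2 = (norm (x - y))\<^sup>2 / 4"
      by (simp add: power_divide)
    finally show ?thesis using I_le[of ?z] by simp
  qed
  have "Cauchy X"
  proof (rule metric_CauchyI)
    fix r :: real assume "r > 0"
    then obtain N where N: "inverse (real (Suc N)) < r\<^sup>2 / 4"
      using reals_Archimedean[of "r\<^sup>2 / 4"] by auto
    have small: "J (X n) - I < r\<^sup>2 / 4" if "n \<ge> N" for n
    proof -
      have "inverse (real (Suc n)) \<le> inverse (real (Suc N))"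
        using that by (intro le_imp_inverse_le) auto
      then show ?thesis using X[of n] N by linarith
    qed
    show "\<exists>N. \<forall>m\<ge>N. \<forall>n\<ge>N. dist (X m) (X n) < r"
    proof (intro exI allI impI)
      fix m n assume mn: "m \<ge> N" "n \<ge> N"
      have "(norm (X m - X n))\<^sup>2 \<le> 2 * (J (X m) - I) + 2 * (J (X n) - I)"
        by (rule dist_X)
      also have "\<dots> < 2 * (r\<^sup>2 / 4) + 2 * (r\<^sup>2 / 4)"
        by (intro add_strict_mono mult_strict_left_mono small mn) simp_all
      finally have "(norm (X m - X n))\<^sup>2 < r\<^sup>2" by simp
      then show "dist (X m) (X n) < r"
        using \<open>r > 0\<close> by (simp add: dist_norm power2_less_imp_less)
    qed
  qed
  then obtain y where y: "X \<longlonglongrightarrow> y" using Cauchy_convergent convergent_def by blast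
  have "(\<lambda>n. J (X n)) \<longlonglongrightarrow> J y"
    unfolding J_def by (intro tendsto_intros \<phi>.tendsto y)
  moreover have "(\<lambda>n. I + inverse (real (Suc n))) \<longlonglongrightarrow> I + 0"
    by (intro tendsto_intros LIMSEQ_inverse_real_of_nat)
  ultimately have "J y \<le> I"
    using X LIMSEQ_le[of "\<lambda>n. J (X n)" "J y" "\<lambda>n. I + inverse (real (Suc n))" I] less_imp_le
    by (metis add.right_neutral)
  have Re_eq: "Re (\<phi> h) = Re (cinner h y)" for h
  proof -
    let ?d = "Re (cinner h y - \<phi> h)"
    have quad: "0 \<le> t\<^sup>2 * (norm h)\<^sup>2 + 2 * t * ?d" for t
    proof -
      have "J y \<le> J (y + t *\<^sub>R h)" using \<open>J y \<le> I\<close> I_le order_trans by blast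
      then show ?thesis
        unfolding J_add
        by (simp add: power_mult_distrib \<phi>.scaleR scaleR_scaleC cinner.scale_left norm_scaleC
            hom algebra_simps)
    qed
    \<comment> \<open>A step close to the minimizer of the quadratic; the summand 1 keeps the denominator positive
      when \<open>h = 0\<close>.\<close>
    let ?t = "- ?d / ((norm h)\<^sup>2 + 1)"
    have pos: "(norm h)\<^sup>2 + 1 > 0" by (simp add: add_nonneg_pos)
    have "?d = 0"
    proof (rule ccontr)
      assume "?d \<noteq> 0"
      then have d2: "?d\<^sup>2 > 0" by simp
      have "?t\<^sup>2 * (norm h)\<^sup>2 + 2 * ?t * ?d
          = ?d\<^sup>2 * ((norm h)\<^sup>2 - 2 * ((norm h)\<^sup>2 + 1)) / ((norm h)\<^sup>2 + 1)\<^sup>2"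
        using pos by (simp add: divide_simps power2_eq_square) (simp add: algebra_simps)
      also have "\<dots> < 0"
      proof (intro divide_neg_pos mult_pos_neg d2 zero_less_power pos)
        have "a - 2 * (a + 1) < 0" if "0 \<le> a" for a :: real
          using that by simp
        then show "(norm h)\<^sup>2 - 2 * ((norm h)\<^sup>2 + 1) < 0"
          by this simp
      qed
      finally show False using quad[of ?t] by simp
    qed
    then show ?thesis by simp
  qed
  \<comment> \<open>The imaginary parts agree by complex linearity, since \<open>Re (\<i> z) = - Im z\<close>.\<close>
  have "\<phi> h = cinner h y" for h
    using Re_eq[of h] Re_eq[of "\<i> *\<^sub>C h"] by (simp add: hom cinner.scale_left complex_eq_iff)
  then show ?thesis by blast
qed

lemma cadjoint_works:
  fixes T :: "'a::complex_hilbert_space \<Rightarrow> 'b::complex_inner"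
  assumes "bounded_clinear T"
  shows "cinner (T x) y = cinner x (cadjoint T y)"
proof -
  have T: "bounded_linear T" "\<And>a x. T (a *\<^sub>C x) = a *\<^sub>C T x"
    using assms by (auto simp: bounded_clinear_def)
  have "\<exists>z. \<forall>x. cinner (T x) y = cinner x z" for y
    using Riesz_representation[OF bounded_linear_compose[OF bounded_linear_cinner_left T(1)]] T(2)
    by (simp add: cinner.scale_left)
  then have "\<exists>S. \<forall>x y. cinner (T x) y = cinner x (S y)"
    by metis
  from someI_ex[OF this] show ?thesis
    unfolding cadjoint_def by blast
qed

lemma cadjoint_bounded:
  fixes T :: "'a::complex_hilbert_space \<Rightarrow> 'b::complex_inner"
  assumes "bounded_clinear T"
  obtains K where "K > 0" "\<And>y. norm (cadjoint T y) \<le> K * norm y"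
proof -
  obtain K where K: "K > 0" "\<And>x. norm (T x) \<le> norm x * K"
    using assms bounded_linear.pos_bounded unfolding bounded_clinear_def by blast
  have "norm (cadjoint T y) \<le> K * norm y" for y
  proof (cases "cadjoint T y = 0")
    case False
    let ?v = "cadjoint T y"
    have "norm ?v * norm ?v = cmod (cinner (T ?v) y)"
      by (simp add: cadjoint_works[OF assms] cinner_self power2_eq_square norm_mult)
    also have "\<dots> \<le> norm (T ?v) * norm y" by (rule cmod_cinner_le)
    also have "\<dots> \<le> norm ?v * (K * norm y)"
      using mult_right_mono[OF K(2)[of ?v], of "norm y"] by (simp add: mult.assoc)
    finally show ?thesis using False by simp
  qed (use K(1) in simp)
  with K(1) show thesis by (rule that)
qed

section \<open>Forms given by pairs of sequences\<close>

definition mixed_form :: "(nat \<Rightarrow> 'a::complex_inner) \<Rightarrow> (nat \<Rightarrow> 'a) \<Rightarrow> 'a \<Rightarrow> 'a \<Rightarrow> complex" where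
  "mixed_form a b f g = (\<Sum>k. cinner f (a k) * cinner (b k) g)"

lemma sesquilinear_cinner_mult:
  "sesquilinear_form (\<lambda>f g. cinner f a * cinner (b::'a::complex_inner) g)"
  by unfold_locales
    (simp_all add: cinner.add_left cinner.add_right cinner.scale_left cinner.scale_right
      algebra_simps)

text \<open>Only finite linear combinations of convergent series enter the polarization identity, so
  conditional convergence on the diagonal is enough.\<close>

lemma summable_mixed_form:
  fixes a b :: "nat \<Rightarrow> 'a::complex_inner"
  assumes "\<And>f. summable (\<lambda>k. cinner f (a k) * cinner (b k) f)"
  shows "summable (\<lambda>k. cinner f (a k) * cinner (b k) g)"
proof -
  have "summable (\<lambda>k. 4 * (cinner f (a k) * cinner (b k) g))"
    unfolding sesquilinear_form.polarization[OF sesquilinear_cinner_mult]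
    by (intro summable_add summable_diff summable_mult assms)
  then show ?thesis by (simp add: summable_cmult_iff)
qed

lemma sesquilinear_mixed_form:
  fixes a b :: "nat \<Rightarrow> 'a::complex_inner"
  assumes "\<And>f. summable (\<lambda>k. cinner f (a k) * cinner (b k) f)"
  shows "sesquilinear_form (mixed_form a b)"
proof
  note summ = summable_mixed_form[OF assms]
  fix x y z :: 'a and c :: complex
  show "mixed_form a b (x + y) z = mixed_form a b x z + mixed_form a b y z"
    unfolding mixed_form_def by (simp add: cinner.add_left distrib_right suminf_add summ)
  show "mixed_form a b x (y + z) = mixed_form a b x y + mixed_form a b x z"
    unfolding mixed_form_def by (simp add: cinner.add_right distrib_left suminf_add summ)
  show "mixed_form a b (c *\<^sub>C x) y = c * mixed_form a b x y"
    unfolding mixed_form_def by (simp add: cinner.scale_left mult.assoc suminf_mult summ)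
  show "mixed_form a b x (c *\<^sub>C y) = cnj c * mixed_form a b x y"
    unfolding mixed_form_def
    by (simp add: cinner.scale_right mult.left_commute suminf_mult summ)
qed

section \<open>Bessel sequences\<close>

definition bessel_sequence :: "(nat \<Rightarrow> 'a::complex_inner) \<Rightarrow> real \<Rightarrow> bool" where
  "bessel_sequence \<phi> M \<longleftrightarrow> (\<forall>f. summable (\<lambda>k. (cmod (cinner f (\<phi> k)))\<^sup>2) \<and>
     (\<Sum>k. (cmod (cinner f (\<phi> k)))\<^sup>2) \<le> M * (norm f)\<^sup>2)"

lemma bessel_form_sums:
  assumes "bessel_sequence \<phi> M"
  shows "(\<lambda>k. cinner f (\<phi> k) * cinner (\<phi> k) f) sums of_real (\<Sum>k. (cmod (cinner f (\<phi> k)))\<^sup>2)"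
  unfolding cinner_mult_commute
  by (intro sums_of_real summable_sums) (use assms in \<open>simp add: bessel_sequence_def\<close>)

lemma positive_bessel_form:
  assumes "bessel_sequence \<phi> M"
  shows "positive_form (mixed_form \<phi> \<phi>)"
proof -
  have diag: "mixed_form \<phi> \<phi> f f = of_real (\<Sum>k. (cmod (cinner f (\<phi> k)))\<^sup>2)" for f
    unfolding mixed_form_def using bessel_form_sums[OF assms, of f] by (rule sums_unique[symmetric])
  have "0 \<le> (\<Sum>k. (cmod (cinner f (\<phi> k)))\<^sup>2)" for f
    using assms by (intro suminf_nonneg) (simp_all add: bessel_sequence_def)
  then show ?thesis
    unfolding positive_form_def positive_form_axioms_def diag
    using sesquilinear_mixed_form[of \<phi> \<phi>] bessel_form_sums[OF assms] sums_summable
    by fastforce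
qed

text \<open>For a finite block \<open>v\<close> of the series, \<open>\<parallel>v\<parallel>\<^sup>2\<close> is the value at \<open>(f, v)\<close> of the positive form
  that belongs to the block. Cauchy--Schwarz bounds \<open>\<parallel>v\<parallel>\<^sup>4\<close> by the product of its diagonal values
  at \<open>f\<close> and \<open>v\<close>; the second is at most \<open>M \<parallel>v\<parallel>\<^sup>2\<close>. Cancelling \<open>\<parallel>v\<parallel>\<^sup>2\<close> bounds the block by
  a block of a convergent series of numbers.\<close>

lemma bessel_series_summable:
  fixes \<phi> :: "nat \<Rightarrow> 'a::complex_hilbert_space"
  assumes "bessel_sequence \<phi> M"
  shows "summable (\<lambda>k. cinner f (\<phi> k) *\<^sub>C \<phi> k)"
proof -
  let ?q = "\<lambda>A f. \<Sum>k\<in>A. (cmod (cinner f (\<phi> k)))\<^sup>2"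
  have block: "(norm (\<Sum>k\<in>A. cinner f (\<phi> k) *\<^sub>C \<phi> k))\<^sup>2 \<le> max M 0 * ?q A f" if "finite A" for A
  proof -
    let ?v = "\<Sum>k\<in>A. cinner f (\<phi> k) *\<^sub>C \<phi> k"
    let ?b = "\<lambda>f g. \<Sum>k\<in>A. cinner f (\<phi> k) * cinner (\<phi> k) g"
    have diag: "?b g g = of_real (?q A g)" for g
      by (simp only: cinner_mult_commute of_real_sum)
    interpret b: positive_form ?b
    proof
      fix x y z :: 'a and a :: complex
      show "Im (?b x x) = 0" "0 \<le> Re (?b x x)"
        unfolding diag by (simp_all add: sum_nonneg)
    qed (simp_all add: cinner.add_left cinner.add_right cinner.scale_left cinner.scale_right
        algebra_simps sum.distrib sum_distrib_left)
    have "cinner (\<Sum>k\<in>A. cinner f (\<phi> k) *\<^sub>C \<phi> k) z = ?b f z" for z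
      by (simp add: linear_sum[OF bounded_linear.linear[OF bounded_linear_cinner_left]]
          cinner.scale_left)
    then have "?b f ?v = of_real ((norm ?v)\<^sup>2)"
      by (metis cinner_self)
    then have "((norm ?v)\<^sup>2)\<^sup>2 \<le> ?q A f * ?q A ?v"
      using b.Cauchy_Schwarz[of f ?v] unfolding diag by (simp add: norm_power)
    moreover have "?q A ?v \<le> max M 0 * (norm ?v)\<^sup>2"
    proof -
      have "?q A ?v \<le> (\<Sum>k. (cmod (cinner ?v (\<phi> k)))\<^sup>2)"
        using assms that by (intro sum_le_suminf) (auto simp: bessel_sequence_def)
      also have "\<dots> \<le> M * (norm ?v)\<^sup>2" using assms by (simp add: bessel_sequence_def)
      also have "\<dots> \<le> max M 0 * (norm ?v)\<^sup>2" by (intro mult_right_mono) auto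
      finally show ?thesis .
    qed
    ultimately have "(norm ?v)\<^sup>2 * (norm ?v)\<^sup>2 \<le> (max M 0 * ?q A f) * (norm ?v)\<^sup>2"
      using mult_left_mono[of "?q A ?v" "max M 0 * (norm ?v)\<^sup>2" "?q A f"]
      by (simp add: power2_eq_square[of "(norm ?v)\<^sup>2"] sum_nonneg algebra_simps)
    then show ?thesis
      by (cases "?v = 0") (simp_all only: mult_le_cancel_right_pos norm_zero zero_less_power
          zero_less_norm_iff not_False_eq_True, simp add: sum_nonneg)
  qed
  have "summable (\<lambda>k. max M 0 * (cmod (cinner f (\<phi> k)))\<^sup>2)"
    using assms by (intro summable_mult) (simp add: bessel_sequence_def)
  note tails = this[unfolded summable_Cauchy]
  show ?thesis
    unfolding summable_Cauchy
  proof (intro allI impI)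
    fix r :: real assume "r > 0"
    then obtain N where N:
        "norm (\<Sum>k=m..<n. max M 0 * (cmod (cinner f (\<phi> k)))\<^sup>2) < r\<^sup>2" if "m \<ge> N" for m n
      using tails by (meson zero_less_power)
    have "norm (\<Sum>k=m..<n. cinner f (\<phi> k) *\<^sub>C \<phi> k) < r" if "m \<ge> N" for m n
    proof (rule power2_less_imp_less)
      show "(norm (\<Sum>k=m..<n. cinner f (\<phi> k) *\<^sub>C \<phi> k))\<^sup>2 < r\<^sup>2"
        using block[of "{m..<n}"] N[OF that, of n]
        by (simp add: sum_distrib_left)
    qed (use \<open>r > 0\<close> in simp)
    then show "\<exists>N. \<forall>m\<ge>N. \<forall>n. norm (\<Sum>k=m..<n. cinner f (\<phi> k) *\<^sub>C \<phi> k) < r" by blast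
  qed
qed

lemma cinner_bessel_series:
  fixes \<phi> :: "nat \<Rightarrow> 'a::complex_hilbert_space"
  assumes "bessel_sequence \<phi> M"
  shows "cinner (\<Sum>k. cinner f (\<phi> k) *\<^sub>C \<phi> k) g = mixed_form \<phi> \<phi> f g"
  unfolding mixed_form_def
  using bounded_linear.suminf[OF bounded_linear_cinner_left bessel_series_summable[OF assms], of f g]
  by (simp add: cinner.scale_left)

section \<open>Controlled frames\<close>

text \<open>Here the frame is a sequence: padding a finite family with zero vectors changes none of the
  series, so one sequence covers finite and infinite index sets. The left inverse \<open>D\<close> of
  \<open>C\<close> serves to recover \<open>\<langle>f, \<phi> k\<rangle>\<close> from coefficients with respect to \<open>C (\<phi> k)\<close>.\<close>

locale controlled_sequence =
  fixes \<phi> :: "nat \<Rightarrow> 'a::complex_hilbert_space" and C D :: "'a \<Rightarrow> 'a" and m M :: real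
  assumes C: "bounded_clinear C" and D: "bounded_clinear D" and DC: "\<And>x. D (C x) = x"
    and m_pos: "m > 0" and M_pos: "M > 0"
    and controlled: "\<And>f. \<exists>s::real. (\<lambda>k. cinner f (C (\<phi> k)) * cinner (\<phi> k) f) sums of_real s \<and>
      m * (norm f)\<^sup>2 \<le> s \<and> s \<le> M * (norm f)\<^sup>2"
begin

abbreviation B :: "'a \<Rightarrow> 'a \<Rightarrow> complex" where
  "B \<equiv> mixed_form (\<lambda>k. C (\<phi> k)) \<phi>"

lemma B_diag: "Im (B f f) = 0" "m * (norm f)\<^sup>2 \<le> Re (B f f)" "Re (B f f) \<le> M * (norm f)\<^sup>2"
proof -
  obtain s :: real where "(\<lambda>k. cinner f (C (\<phi> k)) * cinner (\<phi> k) f) sums of_real s"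
      "m * (norm f)\<^sup>2 \<le> s" "s \<le> M * (norm f)\<^sup>2"
    using controlled[of f] by blast
  moreover from this have "B f f = of_real s"
    unfolding mixed_form_def by (simp add: sums_iff)
  ultimately show "Im (B f f) = 0" "m * (norm f)\<^sup>2 \<le> Re (B f f)" "Re (B f f) \<le> M * (norm f)\<^sup>2"
    by simp_all
qed

lemma summable_B: "summable (\<lambda>k. cinner f (C (\<phi> k)) * cinner (\<phi> k) g)"
  by (rule summable_mixed_form) (metis controlled sums_summable)

sublocale B: positive_form B
proof -
  have "0 \<le> Re (B x x)" for x
    using B_diag(2)[of x] m_pos order_trans[of 0 "m * (norm x)\<^sup>2"] by simp
  then show "positive_form B"
    unfolding positive_form_def positive_form_axioms_def
    using sesquilinear_mixed_form[OF summable_B] B_diag(1) by blast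
qed

lemma cmod_B_le: "cmod (B f g) \<le> M * norm f * norm g"
proof (rule power2_le_imp_le)
  have "(cmod (B f g))\<^sup>2 \<le> Re (B f f) * Re (B g g)" by (rule B.Cauchy_Schwarz)
  also have "\<dots> \<le> (M * (norm f)\<^sup>2) * (M * (norm g)\<^sup>2)"
    using M_pos by (intro mult_mono B_diag B.diag_ge_zero) auto
  finally show "(cmod (B f g))\<^sup>2 \<le> (M * norm f * norm g)\<^sup>2"
    by (simp add: power2_eq_square mult_ac)
qed (use M_pos in simp)

lemma cinner_C: "cinner f (C x) = cinner (cadjoint C f) x"
  using cadjoint_works[OF C, of x f] cinner_commute by metis

lemma cinner_cadjoint_D: "cinner (cadjoint D f) (C x) = cinner f x"
  using cadjoint_works[OF D, of "C x" f] cinner_commute DC by metis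

text \<open>The terms of \<open>B (D\<^sup>*f) f\<close> are \<open>\<bar>\<langle>f, \<phi> k\<rangle>\<bar>\<^sup>2\<close>. This turns the possibly conditional
  convergence of \<open>B\<close> off the diagonal into convergence of a series of nonnegative terms, and the
  bound on \<open>B\<close> into a Bessel bound.\<close>

lemma bessel_bound: obtains M' where "M' > 0" "bessel_sequence \<phi> M'"
proof -
  obtain K where K: "K > 0" "\<And>y. norm (cadjoint D y) \<le> K * norm y"
    using cadjoint_bounded[OF D] by blast
  have "bessel_sequence \<phi> (M * K)"
    unfolding bessel_sequence_def
  proof (intro allI conjI)
    fix f
    have eq: "(cinner (cadjoint D f) (C (\<phi> k)) * cinner (\<phi> k) f)
        = of_real ((cmod (cinner f (\<phi> k)))\<^sup>2)" for k
      by (simp only: cinner_cadjoint_D cinner_mult_commute)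
    show summ: "summable (\<lambda>k. (cmod (cinner f (\<phi> k)))\<^sup>2)"
      using summable_B[of "cadjoint D f" f] unfolding eq by (simp only: summable_of_real_iff)
    then have "B (cadjoint D f) f = of_real (\<Sum>k. (cmod (cinner f (\<phi> k)))\<^sup>2)"
      unfolding mixed_form_def eq by (rule suminf_of_real[symmetric])
    then have "(\<Sum>k. (cmod (cinner f (\<phi> k)))\<^sup>2) \<le> cmod (B (cadjoint D f) f)"
      by (metis abs_ge_self norm_of_real)
    also have "\<dots> \<le> M * norm (cadjoint D f) * norm f" by (rule cmod_B_le)
    also have "\<dots> \<le> M * (K * norm f) * norm f"
      using M_pos by (intro mult_right_mono mult_left_mono K) auto
    finally show "(\<Sum>k. (cmod (cinner f (\<phi> k)))\<^sup>2) \<le> M * K * (norm f)\<^sup>2"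
      by (simp add: power2_eq_square mult_ac)
  qed
  with M_pos K(1) show thesis by (intro that[of "M * K"]) simp_all
qed

text \<open>Since \<open>B f f\<close> is the value of the frame form at \<open>(C\<^sup>*f, f)\<close>, Cauchy--Schwarz gives
  \<open>m\<^sup>2 \<parallel>f\<parallel>\<^sup>4 \<le> M' K\<^sup>2 \<parallel>f\<parallel>\<^sup>2 q(f)\<close>, where \<open>q(f)\<close> is the sum of the \<open>\<bar>\<langle>f, \<phi> k\<rangle>\<bar>\<^sup>2\<close>, \<open>M'\<close> is a Bessel bound
  and \<open>K\<close> bounds \<open>C\<^sup>*\<close>.\<close>

lemma lower_frame_bound:
  obtains m' where "m' > 0" "\<And>f. m' * (norm f)\<^sup>2 \<le> (\<Sum>k. (cmod (cinner f (\<phi> k)))\<^sup>2)"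
proof -
  obtain M' where M': "M' > 0" "bessel_sequence \<phi> M'" using bessel_bound by blast
  obtain K where K: "K > 0" "\<And>y. norm (cadjoint C y) \<le> K * norm y"
    using cadjoint_bounded[OF C] by blast
  let ?P = "mixed_form \<phi> \<phi>" and ?q = "\<lambda>f. \<Sum>k. (cmod (cinner f (\<phi> k)))\<^sup>2"
  interpret P: positive_form ?P by (rule positive_bessel_form[OF M'(2)])
  have diag: "Re (?P f f) = ?q f" for f
    using bessel_form_sums[OF M'(2), of f] unfolding mixed_form_def by (simp add: sums_iff)
  define c where "c = m\<^sup>2 / (M' * K\<^sup>2)"
  have q_nonneg: "0 \<le> ?q f" for f using P.diag_ge_zero[of f] by (simp only: diag)
  have "c * (norm f)\<^sup>2 \<le> ?q f" for f
  proof (cases "f = 0")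
    case False
    have "m * (norm f)\<^sup>2 \<le> cmod (B f f)"
      using B_diag(2)[of f] complex_Re_le_cmod order_trans by blast
    then have "(m * (norm f)\<^sup>2)\<^sup>2 \<le> (cmod (B f f))\<^sup>2"
      using m_pos by (intro power_mono) auto
    also have "B f f = ?P (cadjoint C f) f"
      unfolding mixed_form_def by (simp only: cinner_C)
    also have "(cmod \<dots>)\<^sup>2 \<le> ?q (cadjoint C f) * ?q f"
      using P.Cauchy_Schwarz unfolding diag .
    also have "\<dots> \<le> (M' * (K * norm f)\<^sup>2) * ?q f"
    proof (intro mult_right_mono q_nonneg)
      have "?q (cadjoint C f) \<le> M' * (norm (cadjoint C f))\<^sup>2"
        using M'(2) by (simp add: bessel_sequence_def)
      also have "\<dots> \<le> M' * (K * norm f)\<^sup>2"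
        using M'(1) K by (intro mult_left_mono power_mono) auto
      finally show "?q (cadjoint C f) \<le> M' * (K * norm f)\<^sup>2" .
    qed
    finally have "m\<^sup>2 * (norm f)\<^sup>2 * (norm f)\<^sup>2 \<le> (M' * K\<^sup>2 * ?q f) * (norm f)\<^sup>2"
      by (simp add: power_mult_distrib power2_eq_square[of "(norm f)\<^sup>2"] mult_ac)
    then have "m\<^sup>2 * (norm f)\<^sup>2 \<le> M' * K\<^sup>2 * ?q f"
      using False by simp
    then show ?thesis
      using M'(1) K(1) by (simp add: c_def pos_divide_le_eq mult_ac)
  qed (use q_nonneg in simp)
  moreover have "c > 0" unfolding c_def using m_pos M'(1) K(1) by simp
  ultimately show thesis using that by blast
qed

text \<open>The form of the left-hand side is \<open>cnj (B g f)\<close>, that of the right-hand side is \<open>B f g\<close>; the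
  two agree because a real diagonal forces \<open>B\<close> to be Hermitian.\<close>

lemma intertwining:
  "C (\<Sum>k. cinner f (\<phi> k) *\<^sub>C \<phi> k) = (\<Sum>k. cinner (cadjoint C f) (\<phi> k) *\<^sub>C \<phi> k)"
proof (rule cinner_eqI_left)
  fix g
  obtain M' where M': "bessel_sequence \<phi> M'" using bessel_bound by blast
  interpret P: positive_form "mixed_form \<phi> \<phi>" by (rule positive_bessel_form[OF M'])
  have B_eq: "B x y = mixed_form \<phi> \<phi> (cadjoint C x) y" for x y
    unfolding mixed_form_def by (simp only: cinner_C)
  have "cinner (C (\<Sum>k. cinner f (\<phi> k) *\<^sub>C \<phi> k)) g = mixed_form \<phi> \<phi> f (cadjoint C g)"
    by (simp only: cadjoint_works[OF C] cinner_bessel_series[OF M'])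
  also have "\<dots> = cnj (B g f)" unfolding B_eq by (rule P.hermitian)
  also have "\<dots> = B f g" by (rule B.hermitian[symmetric])
  also have "\<dots> = cinner (\<Sum>k. cinner (cadjoint C f) (\<phi> k) *\<^sub>C \<phi> k) g"
    by (simp only: B_eq cinner_bessel_series[OF M'])
  finally show "cinner (C (\<Sum>k. cinner f (\<phi> k) *\<^sub>C \<phi> k)) g
      = cinner (\<Sum>k. cinner (cadjoint C f) (\<phi> k) *\<^sub>C \<phi> k) g" .
qed

end

section \<open>Controlled frames are frames\<close>

theorem proposition3p2:
  fixes \<Gamma> :: "'i set" and e :: "nat \<Rightarrow> 'i"
    and \<psi> :: "'i \<Rightarrow> 'a::complex_hilbert_space" and C :: "'a \<Rightarrow> 'a"
  assumes "\<exists>D :: 'a set. countable D \<and> closure D = UNIV"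
    and "countable \<Gamma>" and "enumerates e \<Gamma>"
    and "C \<in> GL"
    and "controlled_frame e \<Gamma> C \<psi>"
  shows "is_frame e \<Gamma> \<psi> \<and>
    (\<forall>f. summable (series_term e \<Gamma> (\<lambda>n. cinner f (\<psi> n) *\<^sub>C \<psi> n))) \<and>
    C \<circ> frame_operator e \<Gamma> \<psi> = frame_operator e \<Gamma> \<psi> \<circ> cadjoint C \<and>
    (\<forall>f. summable (series_term e \<Gamma> (\<lambda>n. cinner f (\<psi> n) *\<^sub>C C (\<psi> n))) \<and>
         summable (series_term e \<Gamma> (\<lambda>n. cinner f (C (\<psi> n)) *\<^sub>C \<psi> n)) \<and>
         suminf (series_term e \<Gamma> (\<lambda>n. cinner f (\<psi> n) *\<^sub>C C (\<psi> n))) =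
         suminf (series_term e \<Gamma> (\<lambda>n. cinner f (C (\<psi> n)) *\<^sub>C \<psi> n)))"
proof -
  obtain D where C: "bounded_clinear C" and D: "bounded_clinear D" and DC: "D \<circ> C = id"
    using \<open>C \<in> GL\<close> by (auto simp: GL_def)
  interpret C: bounded_linear C using C by (simp add: bounded_clinear_def)
  have C_scale: "C (a *\<^sub>C x) = a *\<^sub>C C x" for a x using C by (simp add: bounded_clinear_def)
  define \<phi> where "\<phi> = series_term e \<Gamma> \<psi>"
  have terms:
    "series_term e \<Gamma> (\<lambda>n. cinner (\<psi> n) f * cinner f (C (\<psi> n)))
       = (\<lambda>k. cinner f (C (\<phi> k)) * cinner (\<phi> k) f)"
    "series_term e \<Gamma> (\<lambda>n. (cmod (cinner f (\<psi> n)))\<^sup>2) = (\<lambda>k. (cmod (cinner f (\<phi> k)))\<^sup>2)"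
    "series_term e \<Gamma> (\<lambda>n. cinner f (\<psi> n) *\<^sub>C \<psi> n) = (\<lambda>k. cinner f (\<phi> k) *\<^sub>C \<phi> k)"
    "series_term e \<Gamma> (\<lambda>n. cinner f (\<psi> n) *\<^sub>C C (\<psi> n)) = (\<lambda>k. C (cinner f (\<phi> k) *\<^sub>C \<phi> k))"
    "series_term e \<Gamma> (\<lambda>n. cinner f (C (\<psi> n)) *\<^sub>C \<psi> n) = (\<lambda>k. cinner f (C (\<phi> k)) *\<^sub>C \<phi> k)"
    for f
    by (auto simp: \<phi>_def series_term_def fun_eq_iff C_scale C.zero cinner.zero_left
        cinner.zero_right scaleC_zero_left)
  obtain m M where m: "m > 0" and ctrl: "\<And>f. \<exists>s::real.
      (\<lambda>k. cinner f (C (\<phi> k)) * cinner (\<phi> k) f) sums of_real s \<and>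
      m * (norm f)\<^sup>2 \<le> s \<and> s \<le> M * (norm f)\<^sup>2"
    using \<open>controlled_frame e \<Gamma> C \<psi>\<close> unfolding controlled_frame_def terms by blast
  \<comment> \<open>On the zero space \<open>M\<close> may be negative, hence the maximum.\<close>
  interpret controlled_sequence \<phi> C D m "max M 1"
  proof
    show "D (C x) = x" for x using DC by (simp add: fun_eq_iff)
    show "\<exists>s::real. (\<lambda>k. cinner f (C (\<phi> k)) * cinner (\<phi> k) f) sums of_real s \<and>
      m * (norm f)\<^sup>2 \<le> s \<and> s \<le> max M 1 * (norm f)\<^sup>2" for f
      using ctrl[of f] mult_right_mono[of M "max M 1" "(norm f)\<^sup>2"] order_trans by fastforce
  qed (use C D m in auto)
  obtain M' where M': "bessel_sequence \<phi> M'" using bessel_bound by blast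
  obtain m' where m': "m' > 0" "\<And>f. m' * (norm f)\<^sup>2 \<le> (\<Sum>k. (cmod (cinner f (\<phi> k)))\<^sup>2)"
    using lower_frame_bound by blast
  have "is_frame e \<Gamma> \<psi>"
    unfolding is_frame_def terms
    using m' M' by (metis bessel_sequence_def summable_sums)
  moreover have "summable (\<lambda>k. cinner f (\<phi> k) *\<^sub>C \<phi> k)" for f
    by (rule bessel_series_summable[OF M'])
  moreover have "C (\<Sum>k. cinner f (\<phi> k) *\<^sub>C \<phi> k) = (\<Sum>k. C (cinner f (\<phi> k) *\<^sub>C \<phi> k))" for f
    by (rule C.suminf[OF bessel_series_summable[OF M']])
  ultimately show ?thesis
    unfolding terms frame_operator_def
    using intertwining C.summable by (auto simp: fun_eq_iff cinner_C)
qed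

end
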